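(* Let $n,r,t$ be positive integers and let $G=K_{n,\ldots,n,(tr+1)n}$ be the complete $(r+1)$-partite graph with $r$ parts of size $n$ and one part of size $(tr+1)n$. Then $\mathrm{def}(G)=0$ if and only if $n(r+1)$ is even.
   Context: A complete $(r+1)$-partite graph has its vertex set partitioned into $r+1$ nonempty independent sets with every two vertices in different parts adjacent. For a proper edge-coloring $\alpha$ of a graph $G$ (with positive integer colors) and a vertex $v$, let $S(v,\alpha)$ be the set of colors on edges incident to $v$, and $\mathrm{def}(v,\alpha)=\max S(v,\alpha)-\min S(v,\alpha)-|S(v,\alpha)|+1$. The deficiency of $G$ is $\mathrm{def}(G)=\min_\alpha \sum_{v\in V(G)}\mathrm{def}(v,\alpha)$ over all proper edge-colorings $\alpha$ of $G$; equivalently, the minimum number of pendant edges whose attachment to $G$ yields a graph admitting an interval coloring (a proper edge-coloring with colors $1,\ldots,t$, all used, in which every vertex's color set is an integer interval). In particular $\mathrm{def}(G)=0$ iff $G$ has an interval coloring. *)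

theory Defs
  imports Complex_Main "HOL-Library.Disjoint_Sets"
begin

text \<open>A finite simple graph is a finite vertex set together with a set of two-element subsets of it.\<close>

definition simple_graph :: "'a set \<Rightarrow> 'a set set \<Rightarrow> bool" where
  "simple_graph V E \<longleftrightarrow> finite V \<and> (\<forall>e\<in>E. e \<subseteq> V \<and> card e = 2)"

definition complete_multipartite ::
    "'a set \<Rightarrow> 'a set set \<Rightarrow> nat \<Rightarrow> (nat \<Rightarrow> 'a set) \<Rightarrow> bool" where
  "complete_multipartite V E m P \<longleftrightarrow>
     simple_graph V E \<and>
     V = (\<Union>i<m. P i) \<and>
     disjoint_family_on P {..<m} \<and>
     (\<forall>i<m. P i \<noteq> {}) \<and>
     (\<forall>i<m. \<forall>u\<in>P i. \<forall>v\<in>P i. {u, v} \<notin> E) \<and>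
     (\<forall>i<m. \<forall>j<m. i \<noteq> j \<longrightarrow> (\<forall>u\<in>P i. \<forall>v\<in>P j. {u, v} \<in> E))"

definition proper_edge_coloring :: "'a set set \<Rightarrow> ('a set \<Rightarrow> nat) \<Rightarrow> bool" where
  "proper_edge_coloring E \<alpha> \<longleftrightarrow>
     (\<forall>e\<in>E. \<alpha> e > 0) \<and>
     (\<forall>e\<in>E. \<forall>f\<in>E. e \<noteq> f \<and> e \<inter> f \<noteq> {} \<longrightarrow> \<alpha> e \<noteq> \<alpha> f)"

definition spectrum :: "'a set set \<Rightarrow> ('a set \<Rightarrow> nat) \<Rightarrow> 'a \<Rightarrow> nat set" where
  "spectrum E \<alpha> v = \<alpha> ` {e \<in> E. v \<in> e}"

text \<open>An isolated vertex has an empty spectrum, whose maximum and minimum are unspecified;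
  its deficiency is set to 0.\<close>

definition vertex_deficiency :: "'a set set \<Rightarrow> ('a set \<Rightarrow> nat) \<Rightarrow> 'a \<Rightarrow> int" where
  "vertex_deficiency E \<alpha> v =
     (let S = spectrum E \<alpha> v in
      if S = {} then 0 else int (Max S) - int (Min S) - int (card S) + 1)"

definition deficiency :: "'a set \<Rightarrow> 'a set set \<Rightarrow> int" where
  "deficiency V E =
     (LEAST d. \<exists>\<alpha>. proper_edge_coloring E \<alpha> \<and> d = (\<Sum>v\<in>V. vertex_deficiency E \<alpha> v))"

lemma finite_edges:
  assumes "simple_graph V E"
  shows "finite E"
proof (rule finite_subset)
  show "E \<subseteq> Pow V" using assms by (auto simp: simple_graph_def)
  show "finite (Pow V)" using assms by (simp add: simple_graph_def)
qed

lemma ex_proper_edge_coloring: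
  assumes "simple_graph V E"
  shows "\<exists>\<alpha>. proper_edge_coloring E \<alpha>"
proof -
  obtain f :: "'a set \<Rightarrow> nat" where f: "inj_on f E"
    using finite_edges[OF assms] finite_imp_inj_to_nat_seg by blast
  have "proper_edge_coloring E (\<lambda>e. Suc (f e))"
    using f by (auto simp: proper_edge_coloring_def dest: inj_onD)
  then show ?thesis by blast
qed

lemma vertex_deficiency_nonneg:
  assumes "finite E"
  shows "0 \<le> vertex_deficiency E \<alpha> v"
proof (cases "spectrum E \<alpha> v = {}")
  case True
  then show ?thesis by (simp add: vertex_deficiency_def)
next
  case False
  let ?S = "spectrum E \<alpha> v"
  have fin: "finite ?S" using assms by (simp add: spectrum_def)
  have "?S \<subseteq> {Min ?S..Max ?S}" using fin by auto
  then have "card ?S \<le> card {Min ?S..Max ?S}" by (rule card_mono[rotated]) simp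
  moreover have "Min ?S \<le> Max ?S" using fin False by simp
  ultimately show ?thesis using False by (simp add: vertex_deficiency_def Let_def)
qed

text \<open>The minimum defining the deficiency is attained, so the \<open>LEAST\<close> is well defined.\<close>

lemma deficiency_attained_and_le:
  assumes G: "simple_graph V E"
  shows "\<exists>\<alpha>. proper_edge_coloring E \<alpha> \<and> deficiency V E = (\<Sum>v\<in>V. vertex_deficiency E \<alpha> v)"
    and "proper_edge_coloring E \<beta> \<Longrightarrow> deficiency V E \<le> (\<Sum>v\<in>V. vertex_deficiency E \<beta> v)"
proof -
  let ?s = "\<lambda>\<alpha>. \<Sum>v\<in>V. vertex_deficiency E \<alpha> v"
  have nn: "0 \<le> ?s \<alpha>" for \<alpha>
    by (intro sum_nonneg vertex_deficiency_nonneg finite_edges[OF G])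
  obtain \<gamma> where \<gamma>: "proper_edge_coloring E \<gamma>"
    using ex_proper_edge_coloring[OF G] by blast
  obtain \<alpha> where \<alpha>: "proper_edge_coloring E \<alpha>"
    and min: "\<And>\<beta>. proper_edge_coloring E \<beta> \<Longrightarrow> nat (?s \<alpha>) \<le> nat (?s \<beta>)"
    using ex_has_least_nat[of "proper_edge_coloring E" \<gamma> "\<lambda>\<alpha>. nat (?s \<alpha>)"] \<gamma> by blast
  have le: "?s \<alpha> \<le> ?s \<beta>" if "proper_edge_coloring E \<beta>" for \<beta>
    using min[OF that] nn[of \<alpha>] nn[of \<beta>] by linarith
  have eq: "deficiency V E = ?s \<alpha>"
    unfolding deficiency_def by (rule Least_equality) (use \<alpha> le in auto)
  show "\<exists>\<alpha>. proper_edge_coloring E \<alpha> \<and> deficiency V E = ?s \<alpha>" using \<alpha> eq by blast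
  show "proper_edge_coloring E \<beta> \<Longrightarrow> deficiency V E \<le> ?s \<beta>" using le eq by simp
qed

text \<open>Complete multipartite graphs exist for all positive part sizes.\<close>

lemma complete_multipartite_exists:
  fixes s :: "nat \<Rightarrow> nat"
  assumes "\<forall>i<m. s i > 0"
  shows "\<exists>(V :: (nat \<times> nat) set) E P. complete_multipartite V E m P \<and> (\<forall>i<m. card (P i) = s i)"
proof -
  define P where "P = (\<lambda>i. {i} \<times> {..<s i})"
  define V where "V = (\<Union>i<m. P i)"
  define E where "E = {{u, v} | u v. u \<in> V \<and> v \<in> V \<and> fst u \<noteq> fst v}"
  have "simple_graph V E"
    by (auto simp: simple_graph_def E_def V_def P_def card_2_iff)
  moreover have "disjoint_family_on P {..<m}"
    by (auto simp: disjoint_family_on_def P_def)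
  moreover have "\<forall>i<m. P i \<noteq> {}" using assms by (auto simp: P_def)
  moreover have "\<forall>i<m. \<forall>u\<in>P i. \<forall>v\<in>P i. {u, v} \<notin> E"
    by (auto simp: E_def P_def doubleton_eq_iff)
  moreover have "{u, v} \<in> E" if "i < m" "j < m" "i \<noteq> j" "u \<in> P i" "v \<in> P j" for i j u v
  proof -
    have "u \<in> V" "v \<in> V" "fst u \<noteq> fst v" using that by (auto simp: V_def P_def)
    then show ?thesis unfolding E_def by blast
  qed
  ultimately have "complete_multipartite V E m P"
    unfolding complete_multipartite_def by (auto simp: V_def)
  moreover have "\<forall>i<m. card (P i) = s i" by (simp add: P_def card_cartesian_product)
  ultimately show ?thesis by blast
qed

end

theory Submission
  imports Defs "HOL-Number_Theory.Cong"
begin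

text \<open>
  Put \<open>q = r n\<close>. Every vertex of a small part has degree \<open>q (t + 1)\<close>, every vertex of the large
  part has degree \<open>q\<close>. In a coloring of deficiency 0 the colors at each vertex form an interval, so
  the edges whose color is divisible by \<open>q\<close> meet each vertex in exactly \<open>1/q\<close> of its edges;
  the handshake lemma for these edges shows that \<open>2 t r n + n (r + 1)\<close> is even.

  Conversely, split the large part into a set \<open>B\<^sub>0\<close> of size \<open>n\<close> and \<open>t\<close> blocks of size \<open>q\<close>.
  The small parts together with \<open>B\<^sub>0\<close> induce a balanced complete multipartite graph of even order,
  which is colored with \<open>q\<close> colors by a 1-factorization; each block yields a \<open>K\<^bsub>q,q\<^esub>\<close>, colored
  with the next \<open>q\<close> colors. The 1-factorization is obtained by replacing each vertex by
  independent copies in \<open>K\<^bsub>r+1\<^esub>\<close> if \<open>r + 1\<close> is even, and in \<open>K\<^bsub>2(r+1)\<^esub>\<close> minus a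
  perfect matching if \<open>n\<close> is even.
\<close>

section \<open>One-factorizations\<close>

text \<open>For a symmetric irreflexive \<open>R\<close> this is a 1-factorization of a
  \<open>d\<close>-regular graph: each of the colors below \<open>d\<close> occurs exactly once at
  each vertex, so every color class is a perfect matching. Colors are a function of two vertices,
  not of an edge, so that they can be pulled back along vertex maps; on non-adjacent pairs only
  symmetry is asked.\<close>

definition factor_coloring ::
    "'a set \<Rightarrow> ('a \<Rightarrow> 'a \<Rightarrow> bool) \<Rightarrow> nat \<Rightarrow> ('a \<Rightarrow> 'a \<Rightarrow> nat) \<Rightarrow> bool" where
  "factor_coloring W R d c \<longleftrightarrow>
     (\<forall>u\<in>W. \<forall>v\<in>W. c u v = c v u) \<and> (\<forall>v\<in>W. bij_betw (c v) {u\<in>W. R v u} {..<d})"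

lemma bij_betw_if_card_eq:
  assumes "finite B" "inj_on f A" "f ` A \<subseteq> B" "card A = card B"
  shows "bij_betw f A B"
  using assms card_subset_eq[of B "f ` A"] card_image[of f A] by (auto simp: bij_betw_def)

lemma inj_on_add_mod:
  fixes a k :: nat
  shows "inj_on (\<lambda>y. (a + y) mod k) {..<k}"
proof (rule inj_onI)
  fix x y assume xy: "x \<in> {..<k}" "y \<in> {..<k}" and "(a + x) mod k = (a + y) mod k"
  then have "[a + x = a + y] (mod k)" by (simp add: cong_def)
  then have "[x = y] (mod k)" by (simp add: cong_add_lcancel_nat)
  with xy show "x = y" by (simp add: cong_def)
qed

text \<open>The round-robin construction: the vertices below \<open>M\<close> are residues,
  \<open>M\<close> is a point at infinity. The edge \<open>ij\<close> gets the color
  \<open>i + j\<close>, which leaves \<open>2 * i\<close> free at \<open>i\<close> for the edge to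
  \<open>M\<close>. At \<open>M\<close> the colors \<open>2 * i\<close> are distinct because
  \<open>M\<close> is odd.\<close>

lemma factor_coloring_complete:
  fixes M :: nat
  assumes "odd M"
  defines "c \<equiv> \<lambda>i j. ((if i = M then j else i) + (if j = M then i else j)) mod M"
  shows "factor_coloring {..M} (\<noteq>) M c"
  unfolding factor_coloring_def
proof (intro conjI ballI)
  have M: "M > 0" using assms(1) by (cases M) auto
  fix u v assume "u \<in> {..M}" "v \<in> {..M}"
  then show "c u v = c v u" by (auto simp: c_def add.commute)
next
  have M: "M > 0" using assms(1) by (cases M) auto
  fix v assume v: "v \<in> {..M}"
  show "bij_betw (c v) {u \<in> {..M}. v \<noteq> u} {..<M}"
  proof (rule bij_betw_if_card_eq)
    have "{u \<in> {..M}. v \<noteq> u} = {..M} - {v}" by auto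
    then show "card {u \<in> {..M}. v \<noteq> u} = card {..<M}" using v by simp
    show "c v ` {u \<in> {..M}. v \<noteq> u} \<subseteq> {..<M}" using M by (auto simp: c_def)
    show "inj_on (c v) {u \<in> {..M}. v \<noteq> u}"
    proof (cases "v = M")
      case True
      show ?thesis
      proof (rule inj_onI)
        fix x y assume xy: "x \<in> {u \<in> {..M}. v \<noteq> u}" "y \<in> {u \<in> {..M}. v \<noteq> u}" "c v x = c v y"
        then have "x < M" "y < M" using True by auto
        then have "[2 * x = 2 * y] (mod M)" using xy True by (simp add: c_def cong_def mult_2)
        moreover have "coprime 2 M" using assms(1) by simp
        ultimately have "[x = y] (mod M)" by (simp add: cong_mult_lcancel_nat)
        then show "x = y" using \<open>x < M\<close> \<open>y < M\<close> by (simp add: cong_def)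
      qed
    next
      case False
      \<comment> \<open>Seen from \<open>v\<close>, the neighbor \<open>M\<close> takes the place of
        the residue \<open>v\<close> itself, so the colors at \<open>v\<close> are a translation of
        distinct residues.\<close>
      define g where "g = (\<lambda>j. if j = M then v else j)"
      have "inj_on g {u \<in> {..M}. v \<noteq> u}" "g ` {u \<in> {..M}. v \<noteq> u} \<subseteq> {..<M}"
        using v False by (auto simp: g_def inj_on_def split: if_splits)
      then have "inj_on ((\<lambda>y. (v + y) mod M) \<circ> g) {u \<in> {..M}. v \<noteq> u}"
        by (blast intro: comp_inj_on inj_on_subset[OF inj_on_add_mod])
      moreover have "c v = (\<lambda>y. (v + y) mod M) \<circ> g" using False by (auto simp: c_def g_def)
      ultimately show ?thesis by simp
    qed
  qed simp
qed

text \<open>The color class removed here is the perfect matching \<open>u + v = M\<close>.\<close>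

lemma factor_coloring_cocktail_party:
  fixes M :: nat
  assumes "odd M"
  shows "\<exists>c. factor_coloring {..M} (\<lambda>u v. u \<noteq> v \<and> u + v \<noteq> M) (M - 1) c"
proof -
  define c where "c = (\<lambda>i j. ((if i = M then j else i) + (if j = M then i else j)) mod M)"
  have c: "factor_coloring {..M} (\<noteq>) M c"
    unfolding c_def by (rule factor_coloring_complete[OF assms])
  have M: "M > 0" using assms by (cases M) auto
  \<comment> \<open>A sum of two distinct residues is positive and below \<open>2 * M\<close>, so it
    vanishes modulo \<open>M\<close> only if it equals \<open>M\<close>. For an edge to
    \<open>M\<close> the color \<open>2 * x\<close> vanishes only at \<open>x = 0\<close>, since
    \<open>M\<close> is odd.\<close>
  have zero: "c u v = 0 \<longleftrightarrow> u + v = M" if uv: "u \<le> M" "v \<le> M" "u \<noteq> v" for u v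
  proof -
    have *: "x mod M = 0 \<longleftrightarrow> x = 0 \<or> x = M" if "x < 2 * M" for x
      using that M by (cases "x < M") (auto simp: mod_if)
    have **: "(2 * x) mod M = 0 \<longleftrightarrow> x = 0" if "x < M" for x
      using *[of "2 * x"] that assms by auto
    consider "u = M" "v < M" | "v = M" "u < M" | "u < M" "v < M" using uv by linarith
    then show ?thesis
    proof cases
      case 1 then show ?thesis using **[of v] by (simp add: c_def mult_2)
    next
      case 2 then show ?thesis using **[of u] by (simp add: c_def mult_2)
    next
      case 3 then show ?thesis using *[of "u + v"] uv(3) by (auto simp: c_def)
    qed
  qed
  \<comment> \<open>The surviving colors 1 to \<open>M - 1\<close> shift down by one. Truncated
    subtraction sends 0 to 0 only on pairs that are no longer adjacent.\<close>
  have "factor_coloring {..M} (\<lambda>u v. u \<noteq> v \<and> u + v \<noteq> M) (M - 1) (\<lambda>u v. c u v - 1)"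
    unfolding factor_coloring_def
  proof (intro conjI ballI)
    fix u v assume "u \<in> {..M}" "v \<in> {..M}"
    then show "c u v - 1 = c v u - 1" using c by (simp add: factor_coloring_def)
  next
    fix v assume v: "v \<in> {..M}"
    let ?N = "{u \<in> {..M}. v \<noteq> u}" and ?N' = "{u \<in> {..M}. v \<noteq> u \<and> v + u \<noteq> M}"
    have bij: "bij_betw (c v) ?N {..<M}" using c v by (simp add: factor_coloring_def)
    have pos: "c v u > 0 \<longleftrightarrow> v + u \<noteq> M" if "u \<in> ?N" for u
      using zero[of v u] v that by auto
    have "c v ` ?N' = {0<..<M}"
    proof (intro equalityI subsetI)
      fix z assume "z \<in> c v ` ?N'"
      then show "z \<in> {0<..<M}" using pos bij_betwE[OF bij] by auto
    next
      fix z assume z: "z \<in> {0<..<M}"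
      then obtain u where "u \<in> ?N" "z = c v u" using bij by (auto simp: bij_betw_def)
      then show "z \<in> c v ` ?N'" using pos z by auto
    qed
    moreover have "inj_on (c v) ?N'" using bij by (auto simp: bij_betw_def intro: inj_on_subset)
    ultimately have "bij_betw (c v) ?N' {0<..<M}" by (simp add: bij_betw_def)
    moreover have "bij_betw (\<lambda>x. x - 1) {0<..<M} {..<M - 1}"
      by (rule bij_betw_byWitness[where f' = Suc]) auto
    ultimately show "bij_betw (\<lambda>u. c v u - 1) ?N' {..<M - 1}"
      using bij_betw_trans by (fastforce simp: comp_def)
  qed
  then show ?thesis by blast
qed

text \<open>Each edge of the base graph becomes a copy of \<open>K_{k,k}\<close>, colored by the
  Latin square \<open>x + y\<close> modulo \<open>k\<close> within a window of \<open>k\<close>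
  colors indexed by the color of the edge. Division by \<open>k\<close> recovers the base color, and
  the remainder recovers the copy.\<close>

lemma factor_coloring_blow_up:
  assumes c: "factor_coloring W R d c"
  shows "factor_coloring (W \<times> {..<k}) (\<lambda>a b. R (fst a) (fst b)) (d * k)
    (\<lambda>a b. c (fst a) (fst b) * k + (snd a + snd b) mod k)"
  unfolding factor_coloring_def
proof (intro conjI ballI)
  fix a b assume "a \<in> W \<times> {..<k}" "b \<in> W \<times> {..<k}"
  then show "c (fst a) (fst b) * k + (snd a + snd b) mod k
      = c (fst b) (fst a) * k + (snd b + snd a) mod k"
    using c by (auto simp: factor_coloring_def add.commute)
next
  fix a assume "a \<in> W \<times> {..<k}"
  then obtain v x where a: "a = (v, x)" "v \<in> W" "x < k" by auto
  have bij: "bij_betw (c v) {u \<in> W. R v u} {..<d}" using c a by (simp add: factor_coloring_def)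
  let ?N = "{b \<in> W \<times> {..<k}. R (fst a) (fst b)}"
  let ?g = "\<lambda>b. c (fst a) (fst b) * k + (snd a + snd b) mod k"
  have N: "?N = {u \<in> W. R v u} \<times> {..<k}" using a by auto
  show "bij_betw ?g ?N {..<d * k}"
  proof (rule bij_betw_if_card_eq)
    show "card ?N = card {..<d * k}"
      unfolding N using bij_betw_same_card[OF bij] by (simp add: card_cartesian_product)
    show "?g ` ?N \<subseteq> {..<d * k}"
    proof
      fix z assume "z \<in> ?g ` ?N"
      then obtain u y where "u \<in> {u \<in> W. R v u}" and z: "z = c v u * k + (x + y) mod k"
        unfolding N using a by auto
      then have "c v u < d" using bij_betwE[OF bij] by blast
      then have "(c v u + 1) * k \<le> d * k" by (intro mult_right_mono) auto
      moreover have "(x + y) mod k < k" using a by simp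
      ultimately show "z \<in> {..<d * k}" using z by simp
    qed
    show "inj_on ?g ?N"
    proof (rule inj_onI)
      fix b b' assume b: "b \<in> ?N" "b' \<in> ?N" and eq: "?g b = ?g b'"
      have "k > 0" using a by simp
      then have "?g b div k = c v (fst b)" "?g b' div k = c v (fst b')"
        "?g b mod k = (x + snd b) mod k" "?g b' mod k = (x + snd b') mod k"
        by (simp_all add: a)
      then have "c v (fst b) = c v (fst b')" "(x + snd b) mod k = (x + snd b') mod k"
        using eq by metis+
      moreover have "fst b \<in> {u \<in> W. R v u}" "fst b' \<in> {u \<in> W. R v u}"
        "snd b \<in> {..<k}" "snd b' \<in> {..<k}" using b unfolding N by auto
      ultimately show "b = b'"
        using bij inj_on_add_mod[of x k] by (metis (no_types, lifting) bij_betw_def inj_onD prod_eqI)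
    qed
  qed simp
qed

lemma factor_coloring_transfer:
  assumes c: "factor_coloring W R d c" and f: "bij_betw f U W"
    and R: "\<And>u v. u \<in> U \<Longrightarrow> v \<in> U \<Longrightarrow> R (f u) (f v) \<longleftrightarrow> R' u v"
  shows "factor_coloring U R' d (\<lambda>u v. c (f u) (f v))"
  unfolding factor_coloring_def
proof (intro conjI ballI)
  fix u v assume "u \<in> U" "v \<in> U"
  then show "c (f u) (f v) = c (f v) (f u)"
    using c bij_betwE[OF f] by (simp add: factor_coloring_def)
next
  fix v assume v: "v \<in> U"
  have "bij_betw f {u \<in> U. R' v u} {w \<in> W. R (f v) w}"
    using f v R by (auto simp: bij_betw_def inj_on_def)
  moreover have "bij_betw (c (f v)) {w \<in> W. R (f v) w} {..<d}"
    using c v bij_betwE[OF f] by (simp add: factor_coloring_def)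
  ultimately show "bij_betw (\<lambda>u. c (f v) (f u)) {u \<in> U. R' v u} {..<d}"
    using bij_betw_trans by (fastforce simp: comp_def)
qed

text \<open>Bijections between corresponding fibres are chosen separately and glued. This identifies
  the vertices of a multipartite graph with those of a model so that the part labels
  \<open>p\<close> and \<open>s\<close> agree.\<close>

lemma ex_bij_betw_fibres:
  assumes "finite U" "finite W" "p ` U \<subseteq> I" "s ` W \<subseteq> I"
    and card: "\<And>i. i \<in> I \<Longrightarrow> card {u\<in>U. p u = i} = card {w\<in>W. s w = i}"
  shows "\<exists>f. bij_betw f U W \<and> (\<forall>u\<in>U. s (f u) = p u)"
proof -
  have "\<forall>i\<in>I. \<exists>g. bij_betw g {u\<in>U. p u = i} {w\<in>W. s w = i}"
    using assms by (intro ballI finite_same_card_bij) auto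
  then obtain g where g: "\<And>i. i \<in> I \<Longrightarrow> bij_betw (g i) {u\<in>U. p u = i} {w\<in>W. s w = i}"
    by metis
  define f where "f = (\<lambda>u. g (p u) u)"
  have f: "f u \<in> W" "s (f u) = p u" if "u \<in> U" for u
    using bij_betwE[OF g[of "p u"]] that assms(3) by (auto simp: f_def)
  have "inj_on f U"
  proof (rule inj_onI)
    fix u u' assume u: "u \<in> U" "u' \<in> U" "f u = f u'"
    then have "p u = p u'" using f by metis
    moreover have "inj_on (g (p u)) {x\<in>U. p x = p u}"
      using g[of "p u"] u assms(3) by (auto simp: bij_betw_def)
    ultimately show "u = u'" using u by (auto simp: f_def inj_on_def)
  qed
  moreover have "W \<subseteq> f ` U"
  proof
    fix w assume w: "w \<in> W"
    then have "g (s w) ` {u\<in>U. p u = s w} = {w'\<in>W. s w' = s w}"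
      using g[of "s w"] assms(4) by (auto simp: bij_betw_def)
    then obtain u where "u \<in> U" "p u = s w" "w = g (s w) u" using w by blast
    then have "u \<in> U" "w = f u" by (simp_all add: f_def)
    then show "w \<in> f ` U" by blast
  qed
  ultimately show ?thesis using f by (auto simp: bij_betw_def)
qed

text \<open>For even \<open>m\<close> the graph is the blow-up of the complete graph on
  \<open>m\<close> vertices by \<open>n\<close>. For odd \<open>m\<close>, \<open>n = 2 * k\<close>,
  and it is the blow-up by \<open>k\<close> of the complete graph on \<open>2 * m\<close> vertices
  minus a perfect matching, which is complete \<open>m\<close>-partite with parts of size 2.\<close>

lemma factor_coloring_balanced_multipartite:
  assumes "finite U" "p ` U \<subseteq> {..<m}" "\<And>i. i < m \<Longrightarrow> card {u\<in>U. p u = i} = n"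
    and "m > 0" "even (n * m)"
  shows "\<exists>c. factor_coloring U (\<lambda>u v. p u \<noteq> p v) ((m - 1) * n) c"
proof (cases "even m")
  case True
  let ?W = "{..m - 1} \<times> {..<n}"
  have "{w\<in>?W. fst w = i} = {i} \<times> {..<n}" if "i < m" for i using that by auto
  then have "\<exists>f. bij_betw f U ?W \<and> (\<forall>u\<in>U. fst (f u) = p u)"
    using assms by (intro ex_bij_betw_fibres[where I = "{..<m}"])
      (auto simp: card_cartesian_product)
  then obtain f where f: "bij_betw f U ?W" "\<forall>u\<in>U. fst (f u) = p u" by blast
  have "odd (m - 1)" using True assms(4) by simp
  note factor_coloring_blow_up[OF factor_coloring_complete[OF this], of n]
  from factor_coloring_transfer[OF this f(1), of "\<lambda>u v. p u \<noteq> p v"] f(2)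
  show ?thesis by auto
next
  case False
  then obtain k where k: "n = 2 * k" using assms(5) by auto
  define M where "M = 2 * m - 1"
  have M: "odd M" "M + 1 = 2 * m" using assms(4) by (auto simp: M_def)
  let ?W = "{..M} \<times> {..<k}"
  \<comment> \<open>The part \<open>{i, M - i}\<close>, a pair of the removed matching, is labelled
    by its smaller element; as \<open>M + 1 = 2 * m\<close>, the labels are the numbers below
    \<open>m\<close>.\<close>
  define s where "s = (\<lambda>w :: nat \<times> nat. min (fst w) (M - fst w))"
  have fib: "{w\<in>?W. s w = i} = {i, M - i} \<times> {..<k}" if "i < m" for i
    using that M(2) by (auto simp: s_def min_def split: if_splits)
  have "card {w\<in>?W. s w = i} = n" if "i < m" for i
  proof -
    have "i \<noteq> M - i" using that M(2) by linarith
    then show ?thesis using fib[OF that] k by (simp add: card_cartesian_product)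
  qed
  moreover have "s ` ?W \<subseteq> {..<m}" using M(2) by (auto simp: s_def min_def)
  ultimately have "\<exists>f. bij_betw f U ?W \<and> (\<forall>u\<in>U. s (f u) = p u)"
    using assms by (intro ex_bij_betw_fibres[where I = "{..<m}"]) auto
  then obtain f where f: "bij_betw f U ?W" "\<forall>u\<in>U. s (f u) = p u" by blast
  have R: "s a \<noteq> s b \<longleftrightarrow> fst a \<noteq> fst b \<and> fst a + fst b \<noteq> M" if "a \<in> ?W" "b \<in> ?W" for a b
  proof -
    have "fst a \<le> M" "fst b \<le> M" using that by auto
    then show ?thesis by (auto simp: s_def min_def)
  qed
  obtain c where "factor_coloring {..M} (\<lambda>u v. u \<noteq> v \<and> u + v \<noteq> M) (M - 1) c"
    using factor_coloring_cocktail_party[OF M(1)] by blast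
  note blow_up = factor_coloring_blow_up[OF this, of k]
  have "fst (f u) \<noteq> fst (f v) \<and> fst (f u) + fst (f v) \<noteq> M \<longleftrightarrow> p u \<noteq> p v"
    if "u \<in> U" "v \<in> U" for u v
    using R[of "f u" "f v"] f(2) bij_betwE[OF f(1)] that by simp
  from factor_coloring_transfer[OF blow_up f(1) this]
  have "\<exists>c. factor_coloring U (\<lambda>u v. p u \<noteq> p v) ((M - 1) * k) c" by blast
  moreover have "(M - 1) * k = (m - 1) * n"
    using assms(4) by (cases m) (auto simp: M_def k)
  ultimately show ?thesis by simp
qed

section \<open>Edges at a vertex and deficiency zero\<close>

text \<open>Translates between edges at \<open>v\<close> and vertices outside its part: it yields
  the degrees and lets a coloring be checked as a function of two vertices.\<close>

lemma incident_edges: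
  assumes G: "complete_multipartite V E m P" and i: "i < m" "v \<in> P i"
  shows "bij_betw (\<lambda>u. {v, u}) (V - P i) {e\<in>E. v \<in> e}"
  unfolding bij_betw_def
proof
  show "inj_on (\<lambda>u. {v, u}) (V - P i)" by (auto simp: inj_on_def doubleton_eq_iff)
  show "(\<lambda>u. {v, u}) ` (V - P i) = {e\<in>E. v \<in> e}"
  proof (intro equalityI subsetI)
    fix e assume "e \<in> (\<lambda>u. {v, u}) ` (V - P i)"
    then obtain u where u: "u \<in> V" "u \<notin> P i" "e = {v, u}" by auto
    then obtain j where j: "j < m" "u \<in> P j" using G by (auto simp: complete_multipartite_def)
    then have "i \<noteq> j" using u by blast
    then have "{v, u} \<in> E" using G i j unfolding complete_multipartite_def by blast
    then show "e \<in> {e\<in>E. v \<in> e}" using u by simp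
  next
    fix e assume e: "e \<in> {e\<in>E. v \<in> e}"
    then have "card e = 2" "e \<subseteq> V"
      using G by (auto simp: complete_multipartite_def simple_graph_def)
    then obtain u where u: "e = {v, u}" "u \<in> V" using e by (auto simp: card_2_iff)
    then have "u \<notin> P i" using G i e by (auto simp: complete_multipartite_def)
    then show "e \<in> (\<lambda>u. {v, u}) ` (V - P i)" using u by auto
  qed
qed

lemma card_spectrum:
  assumes "proper_edge_coloring E \<alpha>"
  shows "inj_on \<alpha> {e\<in>E. v \<in> e}" "card (spectrum E \<alpha> v) = card {e\<in>E. v \<in> e}"
proof -
  show "inj_on \<alpha> {e\<in>E. v \<in> e}"
    using assms by (auto simp: proper_edge_coloring_def inj_on_def)
  then show "card (spectrum E \<alpha> v) = card {e\<in>E. v \<in> e}"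
    unfolding spectrum_def by (rule card_image)
qed

text \<open>The deficiency counts the integers between minimum and maximum that are missing from the
  spectrum. The interval is half-open so that its length is visibly the number of colors.\<close>

lemma spectrum_interval_if_vertex_deficiency_0:
  assumes "finite E" "spectrum E \<alpha> v \<noteq> {}" "vertex_deficiency E \<alpha> v = 0"
  shows "\<exists>a. spectrum E \<alpha> v = {a..<a + card (spectrum E \<alpha> v)}"
proof -
  let ?S = "spectrum E \<alpha> v"
  have fin: "finite ?S" using assms(1) by (simp add: spectrum_def)
  have sub: "?S \<subseteq> {Min ?S..Max ?S}" using fin by auto
  have le: "Min ?S \<le> Max ?S" using fin assms(2) by simp
  have eq: "Max ?S + 1 = Min ?S + card ?S"
    using assms(2,3) by (simp add: vertex_deficiency_def Let_def)
  then have "card ?S = card {Min ?S..Max ?S}" using le by simp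
  then have "?S = {Min ?S..Max ?S}" using card_subset_eq[OF _ sub] by simp
  also have "\<dots> = {Min ?S..<Min ?S + card ?S}"
    using eq by auto
  finally show ?thesis by blast
qed

lemma vertex_deficiency_0_if_spectrum_interval:
  assumes "spectrum E \<alpha> v = {a..<b}"
  shows "vertex_deficiency E \<alpha> v = 0"
proof (cases "a < b")
  case True
  have "Max {a..<b} = b - 1" "Min {a..<b} = a"
    using True by (auto intro!: Max_eqI Min_eqI)
  then show ?thesis using True assms by (simp add: vertex_deficiency_def of_nat_diff)
next
  \<comment> \<open>The interval is empty, and the default value for an empty spectrum
    applies.\<close>
  case False
  then show ?thesis using assms by (simp add: vertex_deficiency_def)
qed

text \<open>The minimum is attained and all summands are nonnegative, so it vanishes only if every
  summand of some coloring does.\<close>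

lemma deficiency_eq_0_iff:
  assumes G: "simple_graph V E"
  shows "deficiency V E = 0 \<longleftrightarrow>
    (\<exists>\<alpha>. proper_edge_coloring E \<alpha> \<and> (\<forall>v\<in>V. vertex_deficiency E \<alpha> v = 0))"
proof -
  have fin: "finite V" "finite E" using G finite_edges by (auto simp: simple_graph_def)
  have eq: "(\<Sum>v\<in>V. vertex_deficiency E \<alpha> v) = 0 \<longleftrightarrow> (\<forall>v\<in>V. vertex_deficiency E \<alpha> v = 0)" for \<alpha>
    using fin vertex_deficiency_nonneg by (intro sum_nonneg_eq_0_iff) auto
  obtain \<alpha> where \<alpha>: "proper_edge_coloring E \<alpha>"
      "deficiency V E = (\<Sum>v\<in>V. vertex_deficiency E \<alpha> v)"
    using deficiency_attained_and_le(1)[OF G] by blast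
  then have nonneg: "deficiency V E \<ge> 0"
    by (simp add: sum_nonneg vertex_deficiency_nonneg fin)
  show ?thesis
  proof
    assume "deficiency V E = 0"
    then show "\<exists>\<alpha>. proper_edge_coloring E \<alpha> \<and> (\<forall>v\<in>V. vertex_deficiency E \<alpha> v = 0)"
      using \<alpha> eq[of \<alpha>] by auto
  next
    assume "\<exists>\<alpha>. proper_edge_coloring E \<alpha> \<and> (\<forall>v\<in>V. vertex_deficiency E \<alpha> v = 0)"
    then obtain \<beta> where "proper_edge_coloring E \<beta>" "\<forall>v\<in>V. vertex_deficiency E \<beta> v = 0"
      by blast
    then show "deficiency V E = 0"
      using deficiency_attained_and_le(2)[OF G, of \<beta>] eq[of \<beta>] nonneg by simp
  qed
qed

text \<open>Reduces the construction to a symmetric function on pairs of vertices: injectivity at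
  each vertex makes the edge coloring proper, and an interval as image gives deficiency 0.\<close>

lemma deficiency_eq_0_if_symmetric_coloring:
  fixes C :: "'a \<Rightarrow> 'a \<Rightarrow> nat"
  assumes G: "complete_multipartite V E m P"
    and sym: "\<And>u v. u \<in> V \<Longrightarrow> v \<in> V \<Longrightarrow> C u v = C v u"
    and bij: "\<And>i v. i < m \<Longrightarrow> v \<in> P i \<Longrightarrow> \<exists>a b. bij_betw (C v) (V - P i) {a..<b}"
  shows "deficiency V E = 0"
proof -
  have V: "V = (\<Union>i<m. P i)" and simple: "simple_graph V E"
    using G by (auto simp: complete_multipartite_def)
  \<comment> \<open>Symmetry of \<open>C\<close> makes the choice independent of the order of the
    two ends. \<open>Suc\<close> is there because colors must be positive while \<open>C\<close> may
    take the value 0.\<close>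
  define \<alpha> where "\<alpha> = (\<lambda>e. Suc (SOME k. \<exists>u\<in>V. \<exists>v\<in>V. e = {u, v} \<and> k = C u v))"
  have \<alpha>: "\<alpha> {u, v} = Suc (C u v)" if "u \<in> V" "v \<in> V" for u v
  proof -
    have "(SOME k. \<exists>x\<in>V. \<exists>y\<in>V. {u, v} = {x, y} \<and> k = C x y) = C u v"
      using that sym by (intro some_equality) (auto simp: doubleton_eq_iff)
    then show ?thesis by (simp add: \<alpha>_def)
  qed
  have *: "\<exists>a b. bij_betw \<alpha> {e\<in>E. v \<in> e} {a..<b}" if v: "v \<in> V" for v
  proof -
    obtain i where i: "i < m" "v \<in> P i" using v V by auto
    obtain a b where ab: "bij_betw (C v) (V - P i) {a..<b}" using bij[OF i] by blast
    have "bij_betw Suc {a..<b} {Suc a..<Suc b}" by (auto simp: bij_betw_def)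
    from bij_betw_trans[OF ab this]
    have "bij_betw (\<alpha> \<circ> (\<lambda>u. {v, u})) (V - P i) {Suc a..<Suc b}"
      by (rule iffD1[OF bij_betw_cong, rotated]) (use \<alpha> v in auto)
    then have "bij_betw \<alpha> {e\<in>E. v \<in> e} {Suc a..<Suc b}"
      using bij_betw_comp_iff[OF incident_edges[OF G i]] by blast
    then show ?thesis by blast
  qed
  have "\<alpha> e \<noteq> \<alpha> f" if ef: "e \<in> E" "f \<in> E" "e \<noteq> f" "e \<inter> f \<noteq> {}" for e f
  proof -
    obtain v where v: "v \<in> e" "v \<in> f" using ef(4) by blast
    then have "v \<in> V" using ef(1) simple by (auto simp: simple_graph_def)
    then have "inj_on \<alpha> {e\<in>E. v \<in> e}" using * by (auto simp: bij_betw_def)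
    then show ?thesis using ef v inj_onD[of \<alpha> "{e\<in>E. v \<in> e}" e f] by blast
  qed
  then have "proper_edge_coloring E \<alpha>"
    unfolding proper_edge_coloring_def by (auto simp: \<alpha>_def)
  moreover have "vertex_deficiency E \<alpha> v = 0" if v: "v \<in> V" for v
    using *[OF v] vertex_deficiency_0_if_spectrum_interval
    by (auto simp: bij_betw_def spectrum_def)
  ultimately show ?thesis using deficiency_eq_0_iff[OF simple] by blast
qed

section \<open>Necessity of the parity condition\<close>

text \<open>Each window of \<open>q\<close> consecutive integers contains exactly one multiple of
  \<open>q\<close>; the induction appends one window at a time.\<close>

lemma card_multiples_in_interval:
  fixes a q s :: nat
  assumes "q > 0"
  shows "card {x \<in> {a..<a + q * s}. q dvd x} = s"
proof (induction s)
  case (Suc s)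
  let ?b = "a + q * s"
  have "bij_betw (\<lambda>y. (?b + y) mod q) {..<q} {..<q}"
    using assms inj_on_add_mod by (intro bij_betw_if_card_eq) auto
  then have "0 \<in> (\<lambda>y. (?b + y) mod q) ` {..<q}" using assms by (simp add: bij_betw_def)
  then obtain y where y: "y < q" "(?b + y) mod q = 0" by auto
  have "x = ?b + y" if "x \<in> {?b..<?b + q}" "q dvd x" for x
  proof -
    have "(?b + (x - ?b)) mod q = (?b + y) mod q" using that y(2) by simp
    moreover have "x - ?b < q" using that(1) by auto
    ultimately have "x - ?b = y"
      using inj_onD[OF inj_on_add_mod[of ?b q], of "x - ?b" y] y(1) by blast
    then show ?thesis using that by auto
  qed
  then have "{x \<in> {?b..<?b + q}. q dvd x} = {?b + y}" using y by auto
  moreover have "{x \<in> {a..<a + q * Suc s}. q dvd x}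
    = {x \<in> {a..<?b}. q dvd x} \<union> {x \<in> {?b..<?b + q}. q dvd x}" by auto
  ultimately have "card {x \<in> {a..<a + q * Suc s}. q dvd x}
    = card ({x \<in> {a..<?b}. q dvd x} \<union> {?b + y})" by simp
  also have "\<dots> = Suc s" using Suc.IH by (subst card_Un_disjoint) auto
  finally show ?case .
qed simp

text \<open>The colors at \<open>v\<close> are \<open>q * s v\<close> consecutive integers, of which
  \<open>s v\<close> are multiples of \<open>q\<close>. Hence the edges with such colors form a
  subgraph with degrees \<open>s v\<close>, and the handshake lemma applies.\<close>

lemma even_sum_degrees_div:
  assumes G: "simple_graph V E" and q: "q > 0" and "deficiency V E = 0"
    and deg: "\<And>v. v \<in> V \<Longrightarrow> card {e\<in>E. v \<in> e} = q * s v"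
  shows "even (\<Sum>v\<in>V. s v)"
proof -
  obtain \<alpha> where \<alpha>: "proper_edge_coloring E \<alpha>" "\<forall>v\<in>V. vertex_deficiency E \<alpha> v = 0"
    using deficiency_eq_0_iff[OF G] assms(3) by blast
  have fin: "finite V" "finite E" using G finite_edges by (auto simp: simple_graph_def)
  define F where "F = {e\<in>E. q dvd \<alpha> e}"
  have finF: "finite F" using fin by (simp add: F_def)
  have "card {e\<in>F. v \<in> e} = s v" if v: "v \<in> V" for v
  proof -
    have cs: "card (spectrum E \<alpha> v) = q * s v" using card_spectrum[OF \<alpha>(1)] deg[OF v] by simp
    have "card {e\<in>F. v \<in> e} = card (\<alpha> ` {e\<in>F. v \<in> e})"
      by (rule card_image[symmetric], rule inj_on_subset[OF card_spectrum(1)[OF \<alpha>(1), of v]])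
        (auto simp: F_def)
    also have "\<alpha> ` {e\<in>F. v \<in> e} = {x \<in> spectrum E \<alpha> v. q dvd x}"
      by (auto simp: F_def spectrum_def)
    also have "card \<dots> = s v"
    proof (cases "spectrum E \<alpha> v = {}")
      case True
      then show ?thesis using cs q by simp
    next
      case False
      then obtain a where "spectrum E \<alpha> v = {a..<a + q * s v}"
        using spectrum_interval_if_vertex_deficiency_0[OF fin(2) False] \<alpha>(2) v cs by auto
      then show ?thesis using card_multiples_in_interval[OF q] by simp
    qed
    finally show ?thesis .
  qed
  then have "(\<Sum>v\<in>V. s v) = (\<Sum>v\<in>V. card {e\<in>F. v \<in> e})" by simp
  also have "\<dots> = 2 * card F"
  proof (rule sum_multicount[OF fin(1) finF], intro ballI)
    fix e assume "e \<in> F"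
    then have "{v\<in>V. v \<in> e} = e" "card e = 2" using G by (auto simp: F_def simple_graph_def)
    then show "card {v\<in>V. v \<in> e} = 2" by simp
  qed
  finally show ?thesis by simp
qed

section \<open>The characterization\<close>

theorem theorem9:
  fixes n r t :: nat and V :: "'a set" and E :: "'a set set" and P :: "nat \<Rightarrow> 'a set"
  assumes "n > 0" and "r > 0" and "t > 0"
    and "complete_multipartite V E (r + 1) P"
    and "\<forall>i<r. card (P i) = n"
    and "card (P r) = (t * r + 1) * n"
  shows "deficiency V E = 0 \<longleftrightarrow> even (n * (r + 1))"
proof -
  note G = assms(4)
  have simple: "simple_graph V E" and V: "V = (\<Union>i<r + 1. P i)"
    and "disjoint_family_on P {..<r + 1}"
    using G unfolding complete_multipartite_def by blast+
  then have disj: "P i \<inter> P j = {}" if "i < r + 1" "j < r + 1" "i \<noteq> j" for i j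
    using that by (auto dest: disjoint_family_onD)
  have finV: "finite V" using simple by (simp add: simple_graph_def)
  have finP: "finite (P i)" if "i < r + 1" for i
    using that V finV by (auto intro: finite_subset)
  define A where "A = (\<Union>i<r. P i)"
  \<comment> \<open>The size of \<open>A\<close> and the degree of every vertex of
    \<open>P r\<close>; it divides all degrees.\<close>
  define q where "q = r * n"
  have q: "q > 0" using assms by (simp add: q_def)
  have cardA: "card A = q"
    unfolding A_def using finP disj assms(5) by (subst card_UN_disjoint) (auto simp: q_def)
  have finA: "finite A" unfolding A_def using finP by auto
  have VA: "V = A \<union> P r" "A \<inter> P r = {}"
    using V disj by (auto simp: A_def less_Suc_eq)
  have cardV: "card V = q + (t * r + 1) * n"
    using VA cardA finA finP[of r] assms(6) by (simp add: card_Un_disjoint)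
  have VP: "V - P r = A" using VA by auto
  show ?thesis
  proof
    assume def0: "deficiency V E = 0"
    \<comment> \<open>Degree divided by \<open>q\<close>: a vertex of \<open>A\<close> misses only
      its own part of size \<open>n\<close>, so its degree is
      \<open>q + t * r * n = q * (t + 1)\<close>.\<close>
    define s where "s = (\<lambda>v. if v \<in> A then t + 1 else 1)"
    have "even (\<Sum>v\<in>V. s v)"
    proof (rule even_sum_degrees_div[OF simple q def0])
      fix v assume "v \<in> V"
      then obtain i where i: "i < r + 1" "v \<in> P i" using V by auto
      have "card {e\<in>E. v \<in> e} = card (V - P i)"
        using bij_betw_same_card[OF incident_edges[OF G i]] by simp
      also have "\<dots> = q * s v"
      proof (cases "i = r")
        case True
        then have "v \<notin> A" using i VA by auto
        then show ?thesis using True VP cardA by (simp add: s_def)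
      next
        case False
        then have "i < r" using i by simp
        then have "v \<in> A" using i by (auto simp: A_def)
        moreover have "P i \<subseteq> V" using V i by auto
        ultimately show ?thesis using cardV assms(5) \<open>i < r\<close> finP[of i]
          by (simp add: card_Diff_subset s_def q_def algebra_simps)
      qed
      finally show "card {e\<in>E. v \<in> e} = q * s v" .
    qed
    also have "(\<Sum>v\<in>V. s v) = (\<Sum>v\<in>A. s v) + (\<Sum>v\<in>P r. s v)"
      unfolding VA(1) using finA finP[of r] VA(2) by (intro sum.union_disjoint) auto
    also have "(\<Sum>v\<in>A. s v) = q * (t + 1)" using cardA by (simp add: s_def)
    also have "(\<Sum>v\<in>P r. s v) = (t * r + 1) * n"
      using VA(2) assms(6) by (subst sum.cong[OF refl, of _ _ "\<lambda>_. 1"]) (auto simp: s_def)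
    also have "q * (t + 1) + (t * r + 1) * n = 2 * (t * r * n) + n * (r + 1)"
      by (simp add: q_def algebra_simps)
    finally show "even (n * (r + 1))" by simp
  next
    assume even: "even (n * (r + 1))"
    have "n \<le> card (P r)" using assms(6) by simp
    \<comment> \<open>\<open>B0\<close> completes the small parts to \<open>r + 1\<close> parts of
      equal size \<open>n\<close>, and exactly \<open>t * q\<close> vertices of \<open>P r\<close>
      remain.\<close>
    then obtain B0 where B0: "B0 \<subseteq> P r" "card B0 = n"
      by (meson obtain_subset_with_card_n)
    define B where "B = P r - B0"
    define U where "U = A \<union> B0"
    have finB0: "finite B0" using B0 finP[of r] finite_subset by auto
    have finU: "finite U" using finA finB0 by (simp add: U_def)
    have finB: "finite B" using finP[of r] by (simp add: B_def)
    have VU: "V = U \<union> B" "U \<inter> B = {}" using VA B0 by (auto simp: U_def B_def)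
    have cardB: "card B = t * q"
      unfolding B_def using assms(6) B0 finB0 by (simp add: card_Diff_subset q_def)

    define p where "p = (\<lambda>v. THE i. i < r + 1 \<and> v \<in> P i)"
    have p: "p v = i" if "i < r + 1" "v \<in> P i" for v i
      unfolding p_def using that disj by (intro the_equality) auto
    have fibre: "{u\<in>U. p u = i} = (if i = r then B0 else P i)" if i: "i < r + 1" for i
    proof -
      have *: "p v < r" "v \<in> P (p v)" if v: "v \<in> A" for v
      proof -
        obtain j where j: "j < r" "v \<in> P j" using v by (auto simp: A_def)
        then have "p v = j" using p by simp
        then show "p v < r" "v \<in> P (p v)" using j by simp_all
      qed
      have **: "p v = r" if "v \<in> B0" for v using that B0 p by auto
      show ?thesis
      proof (cases "i = r")
        case True
        then show ?thesis using * ** by (auto simp: U_def)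
      next
        case False
        then have "i < r" using i by simp
        then have "P i \<subseteq> A" by (auto simp: A_def)
        then show ?thesis using * ** p[OF i] False by (auto simp: U_def)
      qed
    qed
    have "\<exists>c. factor_coloring U (\<lambda>u v. p u \<noteq> p v) ((r + 1 - 1) * n) c"
    proof (rule factor_coloring_balanced_multipartite[OF finU _ _ _ even])
      show "p ` U \<subseteq> {..<r + 1}" using p V VU by blast
      show "card {u\<in>U. p u = i} = n" if "i < r + 1" for i
        using fibre[OF that] that B0 assms(5) by auto
    qed simp
    then obtain c where c: "factor_coloring U (\<lambda>u v. p u \<noteq> p v) q c" by (auto simp: q_def)
    have bijc: "bij_betw (c v) (U - P i) {..<q}" if i: "i < r + 1" "v \<in> P i" "v \<in> U" for i v
    proof -
      have "p u = i \<longleftrightarrow> u \<in> P i" if "u \<in> U" for u using fibre[OF i(1)] that p[OF i(1)] B0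
        by (auto split: if_splits)
      then have "{u\<in>U. p v \<noteq> p u} = U - P i" unfolding p[OF i(1,2)] by blast
      moreover have "bij_betw (c v) {u\<in>U. p v \<noteq> p u} {..<q}"
        using c i(3) by (simp add: factor_coloring_def)
      ultimately show ?thesis by simp
    qed

    obtain f where f: "bij_betw f A {..<q}"
      using finite_same_card_bij[OF finA, of "{..<q}"] cardA by auto
    obtain h where h: "bij_betw h B {..<t * q}"
      using finite_same_card_bij[OF finB, of "{..<t * q}"] cardB by auto
    \<comment> \<open>\<open>h b div q\<close> is the block of \<open>b\<close>, one of
      \<open>t\<close>, and selects a window of \<open>q\<close> colors; inside it a cyclic Latin
      square colors \<open>K_{q,q}\<close>. The summand 1 reserves the colors below \<open>q\<close>
      for \<open>c\<close>.\<close>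
    define D where "D = (\<lambda>a b. q * (1 + h b div q) + (h b + f a) mod q)"
    \<comment> \<open>Pairs inside \<open>P r\<close> are non-adjacent, so no edge takes its color
      from the default 0 or from \<open>D\<close> on \<open>B0\<close> and \<open>B\<close>.\<close>
    define C where "C = (\<lambda>u v. if u \<in> U then if v \<in> U then c u v else D u v else if v \<in> U then D v u else 0)"
    \<comment> \<open>From a fixed \<open>a\<close>, the \<open>t\<close> blocks fill
      \<open>t\<close> consecutive windows.\<close>
    have DA: "bij_betw (D a) B {q..<q + t * q}" for a
    proof (rule bij_betw_if_card_eq)
      show "D a ` B \<subseteq> {q..<q + t * q}"
      proof
        fix z assume "z \<in> D a ` B"
        then obtain b where b: "b \<in> B" "z = D a b" by auto
        have "h b < t * q" using bij_betwE[OF h] b by auto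
        then have "h b div q < t" by (simp add: less_mult_imp_div_less)
        then have "q * (h b div q + 1) \<le> q * t" by (intro mult_left_mono) auto
        moreover have "(h b + f a) mod q < q" using q by simp
        ultimately show "z \<in> {q..<q + t * q}" using b
          by (simp add: D_def algebra_simps)
      qed
      show "inj_on (D a) B"
      proof (rule inj_onI)
        fix b b' assume b: "b \<in> B" "b' \<in> B" and eq: "D a b = D a b'"
        \<comment> \<open>The quotient of a color by \<open>q\<close> reveals the block of
          \<open>b\<close>, and the remainder reveals \<open>h b mod q\<close> after cancelling
          \<open>f a\<close>; together they determine \<open>h b\<close>.\<close>
        have "(q * k + z mod q) div q = k" "(q * k + z mod q) mod q = z mod q" for k z
          using q by simp_all
        then have "D a x div q = 1 + h x div q" "D a x mod q = (h x + f a) mod q" for x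
          unfolding D_def by blast+
        then have "h b div q = h b' div q" and m: "(h b + f a) mod q = (h b' + f a) mod q"
          using eq by (metis add_left_cancel)+
        moreover have "h b mod q = h b' mod q"
          using m cong_add_rcancel_nat[of "h b" "f a" "h b'" q] by (simp add: cong_def)
        ultimately have "h b = h b'" by (metis div_mult_mod_eq)
        then show "b = b'" using h b by (auto simp: bij_betw_def inj_on_def)
      qed
    qed (use cardB in auto)
    \<comment> \<open>From a fixed \<open>b\<close> only the window of its own block is seen, and
      each of its colors once.\<close>
    have DB: "bij_betw (\<lambda>a. D a b) A {q * (1 + h b div q)..<q * (1 + h b div q) + q}" for b
    proof (rule bij_betw_if_card_eq)
      have "inj_on ((\<lambda>y. (h b + y) mod q) \<circ> f) A"
        using f by (auto intro!: comp_inj_on inj_on_subset[OF inj_on_add_mod] simp: bij_betw_def)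
      then show "inj_on (\<lambda>a. D a b) A" by (simp add: D_def inj_on_def)
    qed (use cardA q in \<open>auto simp: D_def\<close>)
    show "deficiency V E = 0"
    proof (rule deficiency_eq_0_if_symmetric_coloring[OF G, of C])
      show "C u v = C v u" if "u \<in> V" "v \<in> V" for u v
        using c by (auto simp: C_def factor_coloring_def)
    next
      fix i v assume i: "i < r + 1" "v \<in> P i"
      \<comment> \<open>A vertex of a small part sees the colors below \<open>q\<close> towards
        \<open>U\<close> and the adjoining range towards \<open>B\<close>; a vertex of
        \<open>B0\<close> sees only the former, a vertex of \<open>B\<close> a single
        window.\<close>
      consider (U) "v \<in> U" "i < r" | (B0) "v \<in> U" "i = r" | (B) "v \<in> B" "i = r"
      proof (cases "i = r")
        case True
        then show thesis using that i by (auto simp: B_def U_def)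
      next
        case False
        then have "i < r" using i by simp
        then show thesis using that(1) i by (auto simp: U_def A_def)
      qed
      then show "\<exists>a b. bij_betw (C v) (V - P i) {a..<b}"
      proof cases
        case U
        have "P i \<inter> B = {}" using disj[of i r] U by (auto simp: B_def)
        then have eq: "V - P i = (U - P i) \<union> B" using VU by auto
        have "bij_betw (C v) (U - P i) {..<q}"
          by (rule iffD1[OF bij_betw_cong bijc[OF i U(1)]]) (use U in \<open>auto simp: C_def\<close>)
        moreover have "bij_betw (C v) B {q..<q + t * q}"
          by (rule iffD1[OF bij_betw_cong DA[of v]]) (use U VU in \<open>auto simp: C_def\<close>)
        ultimately have "bij_betw (C v) (V - P i) ({..<q} \<union> {q..<q + t * q})"
          unfolding eq by (rule bij_betw_combine) auto
        moreover have "{..<q} \<union> {q..<q + t * q} = {0..<q + t * q}" by auto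
        ultimately show ?thesis by metis
      next
        case B0
        have "V - P i = U - P i" using B0 VU by (auto simp: B_def)
        moreover have "bij_betw (C v) (U - P i) {..<q}"
          by (rule iffD1[OF bij_betw_cong bijc[OF i B0(1)]]) (use B0 in \<open>auto simp: C_def\<close>)
        ultimately show ?thesis by (metis lessThan_atLeast0)
      next
        case B
        have "V - P i = A" using VP B by simp
        moreover have "bij_betw (C v) A {q * (1 + h v div q)..<q * (1 + h v div q) + q}"
          by (rule iffD1[OF bij_betw_cong DB[of v]]) (use B VU in \<open>auto simp: C_def U_def\<close>)
        ultimately show ?thesis by metis
      qed
    qed
  qed
qed

end
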